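(* Let $k\ge 1$ and let $D$ be a design matrix, i.e. a square matrix of order $2k$ with entries in $\{-1,1\}$. Then $D$ is an element of $\mathcal{G}(k,1)$ if and only if it can be written as $$D=\begin{bmatrix} M_1 & M_1\\ -N_1 & N_1\end{bmatrix},$$ where $M_1$ and $N_1$ are elements of $\mathcal{M}_k\{-1,1\}$.
   Context: $1_m$ denotes the all-ones column vector of length $m$, and $*$ denotes the Schur (entrywise) product. $\mathcal{M}_k\{-1,1\}$ is the set of non-singular $k\times k$ matrices with entries in $\{-1,1\}$ whose first column is $1_k$. $\mathcal{G}(k,1)$ is the set of saturated design matrices for the mean $F_0$, the main effects $F_1,\dots,F_k$ and the two-factor interactions $F_{12},\dots,F_{1k}$ in a two-level factorial experiment with $k$ factors. That is, it is the set of non-singular $2k\times 2k$ matrices with entries in $\{-1,1\}$ whose columns are, in this order, $F_1,\dots,F_k,F_0,F_{12},\dots,F_{1k}$, where $F_0=1_{2k}=F_1*F_1$ and $F_{1j}=F_1*F_j$ for $2\le j\le k$. Rows (runs) are ordered so that $F_1=\begin{bmatrix}1_{f_+}\\ -1_{f_-}\end{bmatrix}$ for some nonnegative integers $f_+,f_-$ with $f_++f_-=2k$ (the values $f_+,f_-$ are not prescribed). *)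

theory Defs
  imports "Jordan_Normal_Form.Matrix"
begin

definition ones_vec :: "nat \<Rightarrow> real vec" where
  "ones_vec m = vec m (\<lambda>_. 1)"

definition schur_prod :: "real vec \<Rightarrow> real vec \<Rightarrow> real vec" where
  "schur_prod u v = vec (dim_vec u) (\<lambda>i. u $ i * v $ i)"

definition sign_mats :: "nat \<Rightarrow> real mat set" where
  "sign_mats n = {A \<in> carrier_mat n n. elements_mat A \<subseteq> {-1, 1}}"

definition M_set :: "nat \<Rightarrow> real mat set" where
  "M_set k = {A \<in> sign_mats k. invertible_mat A \<and> col A 0 = ones_vec k}"

(* F j is the column of the main effect F_j, for 1 <= j <= k; its values elsewhere are irrelevant.
   The column F_0 of the mean is the all-ones vector, and F_{1j} is the Schur product F_1 * F_j. *)
definition G_set :: "nat \<Rightarrow> real mat set" where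
  "G_set k = {D \<in> sign_mats (2 * k). invertible_mat D \<and>
     (\<exists>F :: nat \<Rightarrow> real vec.
        (\<forall>j \<in> {1..k}. F j \<in> carrier_vec (2 * k)) \<and>
        D = mat_of_cols (2 * k)
              (map F [1..<k + 1] @ [ones_vec (2 * k)] @
               map (\<lambda>j. schur_prod (F 1) (F j)) [2..<k + 1]) \<and>
        (\<exists>fp fm :: nat. fp + fm = 2 * k \<and> F 1 = ones_vec fp @\<^sub>v (- ones_vec fm)))}"

end

theory Submission
  imports Defs "Jordan_Normal_Form.Matrix_Kernel"
begin

text \<open>
  In a design of the required shape the right half of the matrix is the left half with row \<open>i\<close>
  multiplied by the sign \<open>F\<^sub>1(i)\<close>, so the matrix is the block matrix of \<open>M, M, -N, N\<close>, where \<open>M\<close> has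
  \<open>f\<^sub>+\<close> rows, \<open>N\<close> has \<open>f\<^sub>-\<close> rows and both have \<open>k\<close> columns. The block matrix maps \<open>(x, x)\<close> to
  \<open>(2Mx, 0)\<close> and \<open>(-x, x)\<close> to \<open>(0, 2Nx)\<close>, hence it has trivial kernel iff \<open>M\<close> and \<open>N\<close> do. A matrix
  with trivial kernel has at least as many rows as columns, and \<open>f\<^sub>+ + f\<^sub>- = 2k\<close> then forces
  \<open>f\<^sub>+ = f\<^sub>- = k\<close>.
\<close>

text \<open>With fewer rows than columns, padding by zero rows gives a square singular matrix, and a
  nonzero vector in its kernel is also annihilated by the original rows.\<close>

lemma mat_kernel_trivial_imp_dim_le:
  fixes A :: "'a :: idom mat"
  assumes A: "A \<in> carrier_mat m n" and ker: "mat_kernel A \<subseteq> {0\<^sub>v n}"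
  shows "n \<le> m"
proof (rule ccontr)
  assume "\<not> n \<le> m"
  then have mn: "m < n" by simp
  \<comment> \<open>Row \<open>m\<close>, the first padding row, has its own branch because
    \<open>det_row_0\<close> expects one distinguished zero row in this form.\<close>
  let ?B = "mat\<^sub>r n n (\<lambda>i. if i = m then 0\<^sub>v n else if i < m then row A i else 0\<^sub>v n)"
  have B: "?B \<in> carrier_mat n n" by simp
  have "det ?B = 0" using A by (intro det_row_0[OF mn]) auto
  then obtain v where v: "v \<in> carrier_vec n" "v \<noteq> 0\<^sub>v n" "?B *\<^sub>v v = 0\<^sub>v n"
    using det_0_iff_vec_prod_zero[OF B] by auto
  have "A *\<^sub>v v = 0\<^sub>v m"
  proof (rule eq_vecI)
    fix i assume "i < dim_vec (0\<^sub>v m :: 'a vec)"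
    then have i: "i < m" by simp
    have "(?B *\<^sub>v v) $ i = row A i \<bullet> v" using i mn A by simp
    with v(3) i mn A show "(A *\<^sub>v v) $ i = 0\<^sub>v m $ i" by simp
  qed (use A in simp)
  with v A ker show False by (auto simp: mat_kernel_def)
qed

lemma invertible_mat_iff_mat_kernel_trivial:
  fixes A :: "'a :: field mat"
  assumes A: "A \<in> carrier_mat n n"
  shows "invertible_mat A \<longleftrightarrow> mat_kernel A \<subseteq> {0\<^sub>v n}"
proof
  assume "invertible_mat A"
  then obtain B where AB: "A * B = 1\<^sub>m n" and BA: "B * A = 1\<^sub>m (dim_row B)"
    using A unfolding invertible_mat_def inverts_mat_def by auto
  \<comment> \<open>\<open>invertible_mat\<close> does not state the size of the inverse; comparing
    column counts in the two product equations yields it.\<close>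
  have B: "B \<in> carrier_mat n n"
    using arg_cong[OF AB, of dim_col] arg_cong[OF BA, of dim_col] A by auto
  show "mat_kernel A \<subseteq> {0\<^sub>v n}"
  proof
    fix v assume "v \<in> mat_kernel A"
    then have v: "v \<in> carrier_vec n" "A *\<^sub>v v = 0\<^sub>v n" using A by (auto simp: mat_kernel_def)
    have "v = (B * A) *\<^sub>v v" using v B by (simp add: BA)
    also have "\<dots> = B *\<^sub>v (A *\<^sub>v v)" by (rule assoc_mult_mat_vec[OF B A v(1)])
    also have "\<dots> = 0\<^sub>v n" using v(2) B by auto
    finally show "v \<in> {0\<^sub>v n}" by simp
  qed
next
  assume "mat_kernel A \<subseteq> {0\<^sub>v n}"
  then have "det A \<noteq> 0"
    using det_0_iff_vec_prod_zero[OF A] A by (auto simp: mat_kernel_def)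
  \<comment> \<open>The value \<open>()\<close> fills the record extension of
    \<open>ring_mat\<close>; a unit of this ring comes with a two-sided inverse.\<close>
  from det_non_zero_imp_unit[OF A this, of "()"]
  obtain B where "B \<in> carrier_mat n n" "A * B = 1\<^sub>m n" "B * A = 1\<^sub>m n"
    unfolding Units_def ring_mat_def by auto
  then show "invertible_mat A"
    using A unfolding invertible_mat_def inverts_mat_def by auto
qed

text \<open>On a stacked vector (x, y) the block matrix acts as \<open>M\<close> on x + y and as
  \<open>N\<close> on y - x, and over the reals these two combinations determine x and y. The row
  counts \<open>p\<close> and \<open>q\<close> stay independent, since their equality is only
  deduced later from the trivial kernels.\<close>

lemma mat_kernel_four_block_trivial_iff:
  fixes M N :: "real mat"
  assumes M: "M \<in> carrier_mat p k" and N: "N \<in> carrier_mat q k"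
  shows "mat_kernel (four_block_mat M M (- N) N) \<subseteq> {0\<^sub>v (k + k)} \<longleftrightarrow>
    mat_kernel M \<subseteq> {0\<^sub>v k} \<and> mat_kernel N \<subseteq> {0\<^sub>v k}"
proof -
  let ?D = "four_block_mat M M (- N) N"
  have D: "?D \<in> carrier_mat (p + q) (k + k)" using M N by auto
  have mult: "?D *\<^sub>v (x @\<^sub>v y) = (M *\<^sub>v (x + y)) @\<^sub>v (N *\<^sub>v (y - x))"
    if x: "x \<in> carrier_vec k" and y: "y \<in> carrier_vec k" for x y
  proof -
    have "?D *\<^sub>v (x @\<^sub>v y) = (M *\<^sub>v x + M *\<^sub>v y) @\<^sub>v (- N *\<^sub>v x + N *\<^sub>v y)"
      using M N x y by (intro four_block_mat_mult_vec) auto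
    also have "M *\<^sub>v x + M *\<^sub>v y = M *\<^sub>v (x + y)"
      using mult_add_distrib_mat_vec[OF M x y] by simp
    also have "- N *\<^sub>v x + N *\<^sub>v y = N *\<^sub>v (y - x)"
      unfolding mult_minus_distrib_mat_vec[OF N y x] using N x y
      by (intro eq_vecI) auto
    finally show ?thesis .
  qed
  have zero_app: "x @\<^sub>v y = 0\<^sub>v (m + n) \<longleftrightarrow> x = 0\<^sub>v m \<and> y = 0\<^sub>v n"
    if "x \<in> carrier_vec m" for x y :: "real vec" and m n
  proof -
    have "(0\<^sub>v (m + n) :: real vec) = 0\<^sub>v m @\<^sub>v 0\<^sub>v n" by auto
    then show ?thesis using append_vec_eq[OF that zero_carrier_vec] by auto
  qed
  show ?thesis
  proof
    assume ker: "mat_kernel ?D \<subseteq> {0\<^sub>v (k + k)}"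
    have triv: "x = 0\<^sub>v k \<and> y = 0\<^sub>v k"
      if x: "x \<in> carrier_vec k" and y: "y \<in> carrier_vec k"
        and "M *\<^sub>v (x + y) = 0\<^sub>v p" "N *\<^sub>v (y - x) = 0\<^sub>v q" for x y
    proof -
      have "?D *\<^sub>v (x @\<^sub>v y) = 0\<^sub>v (p + q)"
        unfolding mult[OF x y] using that M by (subst zero_app) auto
      then have "x @\<^sub>v y = 0\<^sub>v (k + k)" using ker x y unfolding mat_kernel[OF D] by auto
      then show ?thesis using zero_app[OF x] by simp
    qed
    \<comment> \<open>Test vector (x, x): the sum is 2x and the difference vanishes.\<close>
    have "x = 0\<^sub>v k" if x: "x \<in> carrier_vec k" and Mx: "M *\<^sub>v x = 0\<^sub>v p" for x
    proof -
      have "M *\<^sub>v (x + x) = 0\<^sub>v p" using mult_add_distrib_mat_vec[OF M x x] Mx by simp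
      moreover have "N *\<^sub>v (x - x) = 0\<^sub>v q" using N x by auto
      ultimately show ?thesis using triv[OF x x] by simp
    qed
    \<comment> \<open>Test vector (-x, x): the sum vanishes and the difference is 2x.\<close>
    moreover have "x = 0\<^sub>v k" if x: "x \<in> carrier_vec k" and Nx: "N *\<^sub>v x = 0\<^sub>v q" for x
    proof -
      have "- x + x = 0\<^sub>v k" using x by auto
      then have "M *\<^sub>v (- x + x) = 0\<^sub>v p" using M by auto
      moreover have "x - - x = x + x" using x by auto
      then have "N *\<^sub>v (x - - x) = 0\<^sub>v q" using mult_add_distrib_mat_vec[OF N x x] Nx by simp
      moreover have "- x \<in> carrier_vec k" using x by simp
      ultimately show ?thesis using triv[OF _ x] by blast
    qed
    ultimately show "mat_kernel M \<subseteq> {0\<^sub>v k} \<and> mat_kernel N \<subseteq> {0\<^sub>v k}"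
      using M N by (auto simp: mat_kernel_def)
  next
    assume ker: "mat_kernel M \<subseteq> {0\<^sub>v k} \<and> mat_kernel N \<subseteq> {0\<^sub>v k}"
    show "mat_kernel ?D \<subseteq> {0\<^sub>v (k + k)}"
    proof
      fix v assume "v \<in> mat_kernel ?D"
      then have v: "v \<in> carrier_vec (k + k)" and Dv: "?D *\<^sub>v v = 0\<^sub>v (p + q)"
        unfolding mat_kernel[OF D] by auto
      obtain x y where x: "x \<in> carrier_vec k" and y: "y \<in> carrier_vec k" and vxy: "v = x @\<^sub>v y"
        using vec_first_last_append[OF v] by (metis vec_first_carrier vec_last_carrier)
      have "M *\<^sub>v (x + y) = 0\<^sub>v p \<and> N *\<^sub>v (y - x) = 0\<^sub>v q"
        using Dv M x y unfolding vxy mult[OF x y] by (subst (asm) zero_app) auto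
      then have *: "x + y = 0\<^sub>v k" "y - x = 0\<^sub>v k"
        using ker add_carrier_vec[OF x y] minus_carrier_vec[OF y x]
        unfolding mat_kernel[OF M] mat_kernel[OF N] by blast+
      \<comment> \<open>Adding and subtracting the two equations gives 2y = 0 and 2x = 0 entrywise,
        and 2 is nonzero in the reals.\<close>
      have "x $ i = 0 \<and> y $ i = 0" if "i < k" for i
      proof -
        have "x $ i + y $ i = 0" "y $ i - x $ i = 0"
          using arg_cong[OF *(1), of "\<lambda>v. v $ i"] arg_cong[OF *(2), of "\<lambda>v. v $ i"] that x y
          by auto
        then show ?thesis by simp
      qed
      then have "x = 0\<^sub>v k \<and> y = 0\<^sub>v k" using x y by auto
      then show "v \<in> {0\<^sub>v (k + k)}" unfolding vxy by auto
    qed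
  qed
qed

text \<open>This is where the balance of the design appears: \<open>p\<close> and \<open>q\<close>
  will be the numbers of runs with F_1 = 1 and F_1 = -1. Trivial kernels give k \<le> p and k \<le>
  q, and the total 2k leaves only equality.\<close>

lemma invertible_four_block_mat_iff:
  fixes M N :: "real mat"
  assumes M: "M \<in> carrier_mat p k" and N: "N \<in> carrier_mat q k" and pq: "p + q = 2 * k"
  shows "invertible_mat (four_block_mat M M (- N) N) \<longleftrightarrow>
    p = k \<and> q = k \<and> invertible_mat M \<and> invertible_mat N"
proof -
  have D: "four_block_mat M M (- N) N \<in> carrier_mat (k + k) (k + k)"
    using four_block_carrier_mat[OF M N] pq by (simp add: mult_2)
  have "p = k \<and> q = k" if "mat_kernel M \<subseteq> {0\<^sub>v k}" "mat_kernel N \<subseteq> {0\<^sub>v k}"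
    using mat_kernel_trivial_imp_dim_le[OF M that(1)] mat_kernel_trivial_imp_dim_le[OF N that(2)] pq
    by simp
  then show ?thesis
    using M N unfolding invertible_mat_iff_mat_kernel_trivial[OF D]
      mat_kernel_four_block_trivial_iff[OF M N]
    by (auto simp: invertible_mat_iff_mat_kernel_trivial)
qed

lemma sign_mats_iff:
  "A \<in> sign_mats n \<longleftrightarrow> A \<in> carrier_mat n n \<and> (\<forall>i<n. \<forall>j<n. A $$ (i, j) \<in> {-1, 1})"
proof -
  have "elements_mat A \<subseteq> S \<longleftrightarrow> (\<forall>i<n. \<forall>j<n. A $$ (i, j) \<in> S)" if "A \<in> carrier_mat n n" for S
    using that by auto
  then show ?thesis unfolding sign_mats_def mem_Collect_eq by (intro conj_cong refl)
qed

lemma design_cols_nth: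
  assumes "j < 2 * k"
  shows "(map F [1..<k + 1] @ [ones_vec (2 * k)] @
      map (\<lambda>j. schur_prod (F 1) (F j)) [2..<k + 1]) ! j =
    (if j < k then F (Suc j) else if j = k then ones_vec (2 * k)
     else schur_prod (F 1) (F (Suc (j - k))))"
proof -
  \<comment> \<open>The interactions start at position k + 1 with factor 2, so position j holds the
    interaction of factor j - k + 1.\<close>
  have "2 + (j - k - 1) = Suc (j - k)" if "k < j" using that by simp
  then show ?thesis using assms by (auto simp: nth_append nth_Cons' simp del: upt_Suc)
qed

text \<open>Eliminates the family \<open>F\<close> in favour of entries of \<open>D\<close>. The
  mean needs no separate clause: it is column k, and the product rule at j = 0 reads F_0 = F_1 *
  F_1, which is all ones because F_1 has entries 1 and -1.\<close>

lemma G_set_iff: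
  assumes k: "k \<ge> 1" and D: "D \<in> sign_mats (2 * k)"
  shows "D \<in> G_set k \<longleftrightarrow> invertible_mat D \<and>
    (\<exists>p q. p + q = 2 * k \<and> (\<forall>i<2 * k. D $$ (i, 0) = (if i < p then 1 else - 1) \<and>
       (\<forall>j<k. D $$ (i, k + j) = D $$ (i, 0) * D $$ (i, j))))"
    (is "_ \<longleftrightarrow> _ \<and> (\<exists>p q. ?P p q)")
proof -
  let ?L = "\<lambda>F. map F [1..<k + 1] @ [ones_vec (2 * k)] @
      map (\<lambda>j. schur_prod (F 1) (F j)) [2..<k + 1]"
  have Dc: "D \<in> carrier_mat (2 * k) (2 * k)" using D by (simp add: sign_mats_iff)
  have len: "length (?L F) = 2 * k" for F using k by (simp del: upt_Suc)
  have "(\<exists>p q. ?P p q) \<longleftrightarrow> (\<exists>F. (\<forall>j \<in> {1..k}. F j \<in> carrier_vec (2 * k)) \<and>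
      D = mat_of_cols (2 * k) (?L F) \<and>
      (\<exists>p q. p + q = 2 * k \<and> F 1 = ones_vec p @\<^sub>v (- ones_vec q)))"
  proof
    assume "\<exists>p q. ?P p q"
    then obtain p q where pq: "p + q = 2 * k"
      and D0: "\<And>i. i < 2 * k \<Longrightarrow> D $$ (i, 0) = (if i < p then 1 else - 1)"
      and Dk: "\<And>i j. i < 2 * k \<Longrightarrow> j < k \<Longrightarrow> D $$ (i, k + j) = D $$ (i, 0) * D $$ (i, j)"
      by blast
    \<comment> \<open>Effects are numbered from 1, matrix columns from 0.\<close>
    define F where "F j = col D (j - 1)" for j
    have F1: "F 1 = ones_vec p @\<^sub>v (- ones_vec q)"
      using k Dc pq D0 unfolding F_def by (intro eq_vecI) (auto simp: ones_vec_def)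
    have "D = mat_of_cols (2 * k) (?L F)"
    proof (rule eq_matI)
      fix i j assume "i < dim_row (mat_of_cols (2 * k) (?L F))"
        and "j < dim_col (mat_of_cols (2 * k) (?L F))"
      then have i: "i < 2 * k" and j: "j < 2 * k" using len by auto
      have "D $$ (i, j) = ?L F ! j $ i"
      \<comment> \<open>The first case holds the main effects and, at j = k, the mean, where the
        square of a sign is 1; the second holds the interactions.\<close>
      proof (cases "j \<le> k")
        case True
        then show ?thesis
          unfolding design_cols_nth[OF j] using i k Dc D0[OF i] Dk[OF i, of 0]
          by (auto simp: F_def ones_vec_def split: if_splits)
      next
        case False
        then have "j - k < k" "k + (j - k) = j" using j by auto
        then show ?thesis
          unfolding design_cols_nth[OF j] using i False Dc Dk[OF i, of "j - k"]
          by (simp add: F_def schur_prod_def)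
      qed
      then show "D $$ (i, j) = mat_of_cols (2 * k) (?L F) $$ (i, j)"
        using i j len by (simp add: mat_of_cols_index del: upt_Suc)
    qed (use Dc len in \<open>auto simp del: upt_Suc\<close>)
    moreover have "\<forall>j \<in> {1..k}. F j \<in> carrier_vec (2 * k)" using Dc by (auto simp: F_def intro!: carrier_vecI)
    ultimately show "\<exists>F. (\<forall>j \<in> {1..k}. F j \<in> carrier_vec (2 * k)) \<and>
      D = mat_of_cols (2 * k) (?L F) \<and>
      (\<exists>p q. p + q = 2 * k \<and> F 1 = ones_vec p @\<^sub>v (- ones_vec q))"
      using F1 pq by blast
  next
    assume "\<exists>F. (\<forall>j \<in> {1..k}. F j \<in> carrier_vec (2 * k)) \<and>
      D = mat_of_cols (2 * k) (?L F) \<and>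
      (\<exists>p q. p + q = 2 * k \<and> F 1 = ones_vec p @\<^sub>v (- ones_vec q))"
    then obtain F p q where Fc: "\<forall>j \<in> {1..k}. F j \<in> carrier_vec (2 * k)"
      and DF: "D = mat_of_cols (2 * k) (?L F)"
      and pq: "p + q = 2 * k" and F1: "F 1 = ones_vec p @\<^sub>v (- ones_vec q)"
      by blast
    have ent: "D $$ (i, j) = (if j < k then F (Suc j) else if j = k then ones_vec (2 * k)
        else schur_prod (F 1) (F (Suc (j - k)))) $ i" if "i < 2 * k" "j < 2 * k" for i j
      using that len unfolding DF design_cols_nth[OF that(2), symmetric]
      by (intro mat_of_cols_index) auto
    have F1i: "F 1 $ i = (if i < p then 1 else - 1)" if "i < 2 * k" for i
      using that pq unfolding F1 by (auto simp: ones_vec_def)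
    \<comment> \<open>\<open>schur_prod\<close> takes its length from its first argument, here
      always \<open>F 1\<close>.\<close>
    have dimF1: "dim_vec (F 1) = 2 * k" using Fc k by auto
    have "D $$ (i, 0) = F 1 $ i" if "i < 2 * k" for i
      using that k by (simp add: ent)
    moreover have "D $$ (i, k + j) = F 1 $ i * D $$ (i, j)" if "i < 2 * k" "j < k" for i j
      using that dimF1 F1i[of i] by (auto simp: ent schur_prod_def ones_vec_def)
    ultimately have "?P p q" using pq F1i by auto
    then show "\<exists>p q. ?P p q" by blast
  qed
  then show ?thesis using D unfolding G_set_def by simp
qed

theorem theorem1:
  fixes k :: nat and D :: "real mat"
  assumes "k \<ge> 1"
    and "D \<in> sign_mats (2 * k)"
  shows "D \<in> G_set k \<longleftrightarrow>
    (\<exists>M\<^sub>1 \<in> M_set k. \<exists>N\<^sub>1 \<in> M_set k. D = four_block_mat M\<^sub>1 M\<^sub>1 (- N\<^sub>1) N\<^sub>1)"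
proof
  have Dc: "D \<in> carrier_mat (2 * k) (2 * k)"
    and Dsign: "\<And>i j. i < 2 * k \<Longrightarrow> j < 2 * k \<Longrightarrow> D $$ (i, j) \<in> {-1, 1}"
    using assms(2) by (auto simp: sign_mats_iff)
  assume "D \<in> G_set k"
  then obtain p q where inv: "invertible_mat D" and pq: "p + q = 2 * k"
    and D0: "\<And>i. i < 2 * k \<Longrightarrow> D $$ (i, 0) = (if i < p then 1 else - 1)"
    and Dk: "\<And>i j. i < 2 * k \<Longrightarrow> j < k \<Longrightarrow> D $$ (i, k + j) = D $$ (i, 0) * D $$ (i, j)"
    unfolding G_set_iff[OF assms] by blast
  define M where "M = mat p k (\<lambda>(i, j). D $$ (i, j))"
  \<comment> \<open>In the lower rows F_1 is -1, so the left half is the negative of the right half.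
    Choosing the right half as \<open>N\<close> makes its first column a piece of F_0, hence all
    ones.\<close>
  define N where "N = mat q k (\<lambda>(i, j). D $$ (p + i, k + j))"
  have M: "M \<in> carrier_mat p k" and N: "N \<in> carrier_mat q k" by (auto simp: M_def N_def)
  have eq: "D = four_block_mat M M (- N) N"
  proof (rule eq_matI)
    fix i j assume "i < dim_row (four_block_mat M M (- N) N)"
      and "j < dim_col (four_block_mat M M (- N) N)"
    then have ij: "i < 2 * k" "j < 2 * k" using M N pq by auto
    show "D $$ (i, j) = four_block_mat M M (- N) N $$ (i, j)"
    proof (cases "j < k")
      case True
      then show ?thesis
        using ij pq M N D0[OF ij(1)] Dk[OF ij(1) True] by (simp add: M_def N_def)
    next
      case False
      then have "j - k < k" "k + (j - k) = j" using ij by auto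
      then show ?thesis
        using ij False pq M N D0[OF ij(1)] Dk[OF ij(1), of "j - k"] by (simp add: M_def N_def)
    qed
  qed (use Dc M N pq in auto)
  have p: "p = k" and q: "q = k" and Minv: "invertible_mat M" and Ninv: "invertible_mat N"
    using inv invertible_four_block_mat_iff[OF M N pq] unfolding eq[symmetric] by auto
  have "M \<in> M_set k"
    using Minv Dsign D0 assms(1) unfolding M_set_def
    by (auto simp: sign_mats_iff M_def p ones_vec_def)
  moreover have "N \<in> M_set k"
    using Ninv Dsign D0 Dk[of _ 0] assms(1) unfolding M_set_def
    by (auto simp: sign_mats_iff N_def p q ones_vec_def)
  ultimately show "\<exists>M\<^sub>1 \<in> M_set k. \<exists>N\<^sub>1 \<in> M_set k. D = four_block_mat M\<^sub>1 M\<^sub>1 (- N\<^sub>1) N\<^sub>1"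
    using eq by blast
next
  assume "\<exists>M\<^sub>1 \<in> M_set k. \<exists>N\<^sub>1 \<in> M_set k. D = four_block_mat M\<^sub>1 M\<^sub>1 (- N\<^sub>1) N\<^sub>1"
  then obtain M N where MN: "M \<in> M_set k" "N \<in> M_set k" and eq: "D = four_block_mat M M (- N) N"
    by blast
  then have M: "M \<in> carrier_mat k k" and N: "N \<in> carrier_mat k k"
    and inv: "invertible_mat M" "invertible_mat N"
    and cols: "col M 0 = ones_vec k" "col N 0 = ones_vec k"
    by (auto simp: M_set_def sign_mats_iff)
  have col0: "M $$ (i, 0) = 1" "N $$ (i, 0) = 1" if "i < k" for i
    using that M N assms(1) arg_cong[OF cols(1), of "\<lambda>v. v $ i"]
      arg_cong[OF cols(2), of "\<lambda>v. v $ i"] by (auto simp: ones_vec_def)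
  have "invertible_mat D"
    using inv invertible_four_block_mat_iff[OF M N] unfolding eq by simp
  \<comment> \<open>Here f_+ = f_- = k: the upper rows repeat \<open>M\<close> with sign 1, and the
    lower rows have right half \<open>N\<close> and left half \<open>- N\<close>, matching the sign
    -1.\<close>
  moreover have "D $$ (i, 0) = (if i < k then 1 else - 1) \<and>
      (\<forall>j<k. D $$ (i, k + j) = D $$ (i, 0) * D $$ (i, j))" if "i < 2 * k" for i
    using that M N assms(1) col0[of i] col0[of "i - k"] unfolding eq by auto
  moreover have "k + k = 2 * k" by simp
  ultimately show "D \<in> G_set k"
    unfolding G_set_iff[OF assms] by blast
qed

end
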